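(* Let $(S,s_0,\zeta_S)$ and $(U,u_0,\zeta_U)$ be finite GKAT automata, let $s\in S$, $u\in U$, and consider the function EQUIV given in the context, started with a fresh union-find object. Then EQUIV$(s,u)$ always terminates, and it is sound and complete in the following sense: (1) EQUIV$(s,u)$ returns true if and only if $s$ and $u$ are trace-equivalent, i.e. $[\![s]\!]=[\![u]\!]$; (2) when ISDEAD and KNOWNDEAD are both replaced by the constant false function, EQUIV$(s,u)$ returns true if and only if $s$ and $u$ are infinite-trace equivalent, i.e. bisimilar.
   Context: Fix a finite set $T=\{t_1,\dots,t_n\}$ of primitive tests and a set $\Sigma$ of primitive actions. An atom is a truth assignment to all of $T$; $\mathbf{At}$ is the (finite) set of atoms. A GKAT automaton is $(S,s_0,\zeta)$ with a finite set of states $S$, a start state $s_0\in S$ and a function $\zeta:S\to\mathbf{At}\to\{\bot,\mathrm{ret}\}+S\times\Sigma$. For an atom $\alpha$: "$s$ accepts $\alpha$" means $\zeta(s)_\alpha=\mathrm{ret}$; "$s$ rejects $\alpha$" means $\zeta(s)_\alpha=\bot$; $s\xrightarrow{\alpha\mid p}s'$ means $\zeta(s)_\alpha=(s',p)$. Trace semantics: $[\![s]\!]$ is the least family of sets of finite words such that: if $s$ accepts $\alpha$ then $\alpha\in[\![s]\!]$; if $s\xrightarrow{\alpha\mid p}s'$ and $w\in[\![s']\!]$ then $\alpha p\cdot w\in[\![s]\!]$. Bisimilarity: $s$ and $u$ are bisimilar if there is a relation $B\subseteq S\times U$ with $(s,u)\in B$ such that for all $(x,y)\in B$ and all $\alpha$,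 one of the following holds: both $x,y$ accept $\alpha$; both reject $\alpha$; or $x\xrightarrow{\alpha\mid p}x'$ and $y\xrightarrow{\alpha\mid p}y'$ for the same $p$, with $(x',y')\in B$. A state is dead if no accepting state (one that accepts at least one atom) is reachable from it by zero or more transitions. ISDEAD$(s)$: if $s$ is in the cache of known dead states, return true; otherwise perform a depth-first search from $s$; if no accepting state is reachable, add all states reachable from $s$ to the cache and return true, else return false. KNOWNDEAD$(s)$ returns whether $s$ is in that cache. A union-find object on the disjoint union $S+U$ is maintained: UNION$(s,u)$ merges the classes of $s$ and $u$, REP$(s)$ returns the representative of the class of $s$. In a fresh union-find object all classes are singletons. Function EQUIV$(s,u)$: - if REP$(s)=$ REP$(u)$, return true; - call UNION$(s,u)$; - if KNOWNDEAD$(s)$, return ISDEAD$(u)$; - if KNOWNDEAD$(u)$, return ISDEAD$(s)$; - return the conjunction, evaluated sequentially with short-circuiting, over all $\alpha\in\mathbf{At}$ of: (i) $s$ accepts $\alpha$ iff $u$ accepts $\alpha$; (ii) if $s\xrightarrow{\alpha\mid p}s'$ and $u$ rejects $\alpha$, then ISDEAD$(s')$; (iii) if $u\xrightarrow{\alpha\mid p}u'$ and $s$ rejects $\alpha$, then ISDEAD$(u')$; (iv) if $s\xrightarrow{\alpha\mid p}s'$, $u\xrightarrow{\alpha\mid q}u'$ and $p\neq q$, then ISDEAD$(s')$ and ISDEAD$(u')$; (v) if $s\xrightarrow{\alpha\mid p}s'$ and $u\xrightarrow{\alpha\mid p}u'$, then EQUIV$(s',u')$ (recursive call, sharing the union-find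 object and the cache). *)

theory Defs
  imports "HOL-Library.FuncSet"
begin

type_synonym 't atom = "'t \<Rightarrow> bool"

text \<open>Truth assignments to \<open>T\<close>, taken \<open>undefined\<close> outside \<open>T\<close> so that each assignment is
  represented by exactly one function.\<close>

definition At :: "'t set \<Rightarrow> 't atom set" where
  "At T = T \<rightarrow>\<^sub>E (UNIV :: bool set)"

text \<open>The sum \<open>{\<bottom>, ret} + S \<times> \<Sigma>\<close>, with \<open>\<bottom>\<close> written \<open>Reject\<close> and \<open>ret\<close> written \<open>Accept\<close>.\<close>

datatype ('s, 'p) outcome = Reject | Accept | Step 's 'p

record ('t, 's, 'p) gkat =
  states :: "'s set"
  start :: 's
  zeta :: "'s \<Rightarrow> 't atom \<Rightarrow> ('s, 'p) outcome"

definition gkat_automaton :: "'t set \<Rightarrow> 'p set \<Rightarrow> ('t, 's, 'p) gkat \<Rightarrow> bool" where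
  "gkat_automaton T \<Sigma> M \<longleftrightarrow>
     finite (states M) \<and> start M \<in> states M \<and>
     (\<forall>s\<in>states M. \<forall>\<alpha>\<in>At T. \<forall>s' p. zeta M s \<alpha> = Step s' p \<longrightarrow> s' \<in> states M \<and> p \<in> \<Sigma>)"


section \<open>Semantics\<close>

text \<open>\<open>is_trace T M s w\<close> means \<open>w \<in> \<lbrakk>s\<rbrakk>\<close>; words are over the alphabet of atoms (\<open>Inl\<close>) and
  actions (\<open>Inr\<close>).\<close>

inductive is_trace :: "'t set \<Rightarrow> ('t, 's, 'p) gkat \<Rightarrow> 's \<Rightarrow> ('t atom + 'p) list \<Rightarrow> bool"
  for T M where
  accept: "\<alpha> \<in> At T \<Longrightarrow> zeta M s \<alpha> = Accept \<Longrightarrow> is_trace T M s [Inl \<alpha>]"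
| step: "\<alpha> \<in> At T \<Longrightarrow> zeta M s \<alpha> = Step s' p \<Longrightarrow> is_trace T M s' w \<Longrightarrow>
    is_trace T M s (Inl \<alpha> # Inr p # w)"

definition traces :: "'t set \<Rightarrow> ('t, 's, 'p) gkat \<Rightarrow> 's \<Rightarrow> ('t atom + 'p) list set" where
  "traces T M s = {w. is_trace T M s w}"

definition bisimulation ::
  "'t set \<Rightarrow> ('t, 's, 'p) gkat \<Rightarrow> ('t, 'u, 'p) gkat \<Rightarrow> ('s \<times> 'u) set \<Rightarrow> bool" where
  "bisimulation T M N B \<longleftrightarrow>
     B \<subseteq> states M \<times> states N \<and>
     (\<forall>(x, y)\<in>B. \<forall>\<alpha>\<in>At T.
        (zeta M x \<alpha> = Accept \<and> zeta N y \<alpha> = Accept) \<or>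
        (zeta M x \<alpha> = Reject \<and> zeta N y \<alpha> = Reject) \<or>
        (\<exists>p x' y'. zeta M x \<alpha> = Step x' p \<and> zeta N y \<alpha> = Step y' p \<and> (x', y') \<in> B))"

definition bisimilar ::
  "'t set \<Rightarrow> ('t, 's, 'p) gkat \<Rightarrow> ('t, 'u, 'p) gkat \<Rightarrow> 's \<Rightarrow> 'u \<Rightarrow> bool" where
  "bisimilar T M N s u \<longleftrightarrow> (\<exists>B. bisimulation T M N B \<and> (s, u) \<in> B)"

definition transition :: "'t set \<Rightarrow> ('t, 's, 'p) gkat \<Rightarrow> 's \<Rightarrow> 's \<Rightarrow> bool" where
  "transition T M s s' \<longleftrightarrow> (\<exists>\<alpha>\<in>At T. \<exists>p. zeta M s \<alpha> = Step s' p)"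

definition dead :: "'t set \<Rightarrow> ('t, 's, 'p) gkat \<Rightarrow> 's \<Rightarrow> bool" where
  "dead T M s \<longleftrightarrow>
     \<not> (\<exists>s'. (transition T M)\<^sup>*\<^sup>* s s' \<and> (\<exists>\<alpha>\<in>At T. zeta M s' \<alpha> = Accept))"


section \<open>Union-find\<close>

text \<open>Any implementation of a union-find object on the carrier \<open>X\<close>: \<open>'d\<close> is its internal state,
  \<open>ok\<close> its representation invariant, and \<open>x\<close>, \<open>y\<close> lie in the same class of \<open>d\<close> iff
  \<open>rep d x = rep d y\<close>.  Which element of a class is its representative is left open.\<close>

locale union_find =
  fixes X :: "'x set"
    and ok :: "'d \<Rightarrow> bool"
    and fresh :: 'd
    and rep :: "'d \<Rightarrow> 'x \<Rightarrow> 'x"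
    and merge :: "'d \<Rightarrow> 'x \<Rightarrow> 'x \<Rightarrow> 'd"
  assumes ok_fresh: "ok fresh"
    and ok_merge: "ok d \<Longrightarrow> x \<in> X \<Longrightarrow> y \<in> X \<Longrightarrow> ok (merge d x y)"
    and rep_in: "ok d \<Longrightarrow> x \<in> X \<Longrightarrow> rep d x \<in> X"
    and rep_rep: "ok d \<Longrightarrow> x \<in> X \<Longrightarrow> rep d (rep d x) = rep d x"
    and rep_fresh: "x \<in> X \<Longrightarrow> y \<in> X \<Longrightarrow> rep fresh x = rep fresh y \<longleftrightarrow> x = y"
    and rep_merge: "ok d \<Longrightarrow> x \<in> X \<Longrightarrow> y \<in> X \<Longrightarrow> a \<in> X \<Longrightarrow> b \<in> X \<Longrightarrow>
      rep (merge d x y) a = rep (merge d x y) b \<longleftrightarrow>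
        rep d a = rep d b \<or>
        rep d a = rep d x \<and> rep d b = rep d y \<or>
        rep d a = rep d y \<and> rep d b = rep d x"

lemma union_find_exists:
  "union_find X (\<lambda>r. \<forall>x\<in>X. r x \<in> X \<and> r (r x) = r x) id (\<lambda>r. r)
     (\<lambda>r x y z. if r z = r x then r y else r z)"
  by unfold_locales auto


section \<open>The algorithm\<close>

text \<open>A computation reads and updates a state \<open>'z\<close> and returns a Boolean; the result \<open>None\<close> means
  divergence, since \<^emph>\<open>partial_function (option)\<close> below takes least fixed points with
  \<open>None\<close> as bottom.\<close>

type_synonym 'z comp = "'z \<Rightarrow> (bool \<times> 'z) option"

definition return :: "bool \<Rightarrow> 'z comp" where
  "return b = (\<lambda>\<sigma>. Some (b, \<sigma>))"

text \<open>Sequential conjunction with short-circuiting.\<close>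

definition conj_then :: "'z comp \<Rightarrow> 'z comp \<Rightarrow> 'z comp" (infixr "&&&&" 35) where
  "(c &&&& c') = (\<lambda>\<sigma>. Option.bind (c \<sigma>) (\<lambda>(b, \<sigma>'). if b then c' \<sigma>' else Some (False, \<sigma>')))"

fun conj_all :: "('a \<Rightarrow> 'z comp) \<Rightarrow> 'a list \<Rightarrow> 'z comp" where
  "conj_all f [] = return True"
| "conj_all f (x # xs) = (f x &&&& conj_all f xs)"

lemma conj_then_mono [partial_function_mono]:
  assumes "\<And>\<sigma>. mono_option (\<lambda>F. c F \<sigma>)" "\<And>\<sigma>. mono_option (\<lambda>F. c' F \<sigma>)"
  shows "mono_option (\<lambda>F. (c F &&&& c' F) \<sigma>)"
proof -
  have "mono_option (\<lambda>F. case r of (b, \<sigma>') \<Rightarrow> if b then c' F \<sigma>' else Some (False, \<sigma>'))" for r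
    using assms(2) by (cases r) (auto intro: partial_function_mono)
  then show ?thesis
    unfolding conj_then_def by (intro bind_mono assms(1))
qed

lemma conj_all_mono [partial_function_mono]:
  assumes "\<And>x \<sigma>. mono_option (\<lambda>F. f F x \<sigma>)"
  shows "mono_option (\<lambda>F. conj_all (f F) xs \<sigma>)"
proof (induction xs arbitrary: \<sigma>)
  case Nil
  then show ?case by (auto intro: partial_function_mono)
next
  case (Cons x xs)
  then show ?case by (simp add: assms conj_then_mono)
qed

definition sum_zeta ::
  "('t, 's, 'p) gkat \<Rightarrow> ('t, 'u, 'p) gkat \<Rightarrow> 's + 'u \<Rightarrow> 't atom \<Rightarrow> ('s + 'u, 'p) outcome" where
  "sum_zeta M N x \<alpha> = (case x of
     Inl s \<Rightarrow> map_outcome Inl id (zeta M s \<alpha>)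
   | Inr u \<Rightarrow> map_outcome Inr id (zeta N u \<alpha>))"

text \<open>Below, \<open>atoms\<close> is the list of all atoms in the order in which they are processed.\<close>

definition successors :: "'t atom list \<Rightarrow> ('x \<Rightarrow> 't atom \<Rightarrow> ('x, 'p) outcome) \<Rightarrow> 'x \<Rightarrow> 'x list" where
  "successors atoms \<zeta> x = concat (map (\<lambda>\<alpha>. case \<zeta> x \<alpha> of Step y p \<Rightarrow> [y] | _ \<Rightarrow> []) atoms)"

text \<open>Depth-first search with an explicit stack; returns the set of visited nodes.\<close>

partial_function (option) dfs :: "('x \<Rightarrow> 'x list) \<Rightarrow> 'x set \<Rightarrow> 'x list \<Rightarrow> 'x set option" where
  "dfs succ visited stack =
     (case stack of
        [] \<Rightarrow> Some visited
      | x # xs \<Rightarrow>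
          if x \<in> visited then dfs succ visited xs
          else dfs succ (insert x visited) (succ x @ xs))"

text \<open>The state of the algorithm consists of the union-find object and the cache of known dead
  states (of both automata).\<close>

type_synonym ('d, 'x) mem = "'d \<times> 'x set"

definition known_dead :: "'x \<Rightarrow> ('d, 'x) mem \<Rightarrow> bool" where
  "known_dead x = (\<lambda>(d, C). x \<in> C)"

definition is_dead ::
  "'t atom list \<Rightarrow> ('x \<Rightarrow> 't atom \<Rightarrow> ('x, 'p) outcome) \<Rightarrow> 'x \<Rightarrow> ('d, 'x) mem comp" where
  "is_dead atoms \<zeta> x = (\<lambda>(d, C).
     if x \<in> C then Some (True, (d, C))
     else Option.bind (dfs (successors atoms \<zeta>) {} [x]) (\<lambda>R.
       if \<exists>y\<in>R. \<exists>\<alpha>\<in>set atoms. \<zeta> y \<alpha> = Accept then Some (False, (d, C))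
       else Some (True, (d, C \<union> R))))"

text \<open>The subroutines ISDEAD (\<open>isd\<close>) and KNOWNDEAD (\<open>kd\<close>) are parameters.\<close>

partial_function (option) equiv_gen ::
  "('d \<Rightarrow> 's + 'u \<Rightarrow> 's + 'u) \<Rightarrow> ('d \<Rightarrow> 's + 'u \<Rightarrow> 's + 'u \<Rightarrow> 'd) \<Rightarrow>
   ('s + 'u \<Rightarrow> ('d, 's + 'u) mem comp) \<Rightarrow> ('s + 'u \<Rightarrow> ('d, 's + 'u) mem \<Rightarrow> bool) \<Rightarrow>
   't atom list \<Rightarrow> ('t, 's, 'p) gkat \<Rightarrow> ('t, 'u, 'p) gkat \<Rightarrow>
   's \<Rightarrow> 'u \<Rightarrow> ('d, 's + 'u) mem \<Rightarrow> (bool \<times> ('d, 's + 'u) mem) option" where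
  "equiv_gen rep merge isd kd atoms M N s u \<sigma> =
     (if rep (fst \<sigma>) (Inl s) = rep (fst \<sigma>) (Inr u) then return True \<sigma>
      else
        let \<sigma>' = (merge (fst \<sigma>) (Inl s) (Inr u), snd \<sigma>) in
        if kd (Inl s) \<sigma>' then isd (Inr u) \<sigma>'
        else if kd (Inr u) \<sigma>' then isd (Inl s) \<sigma>'
        else conj_all (\<lambda>\<alpha>.
               return (zeta M s \<alpha> = Accept \<longleftrightarrow> zeta N u \<alpha> = Accept)
          &&&& (\<lambda>\<sigma>. case (zeta M s \<alpha>, zeta N u \<alpha>) of
                  (Step s' p, Reject) \<Rightarrow> isd (Inl s') \<sigma>
                | _ \<Rightarrow> return True \<sigma>)
          &&&& (\<lambda>\<sigma>. case (zeta M s \<alpha>, zeta N u \<alpha>) of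
                  (Reject, Step u' p) \<Rightarrow> isd (Inr u') \<sigma>
                | _ \<Rightarrow> return True \<sigma>)
          &&&& (\<lambda>\<sigma>. case (zeta M s \<alpha>, zeta N u \<alpha>) of
                  (Step s' p, Step u' q) \<Rightarrow>
                    if p \<noteq> q then (isd (Inl s') &&&& isd (Inr u')) \<sigma> else return True \<sigma>
                | _ \<Rightarrow> return True \<sigma>)
          &&&& (\<lambda>\<sigma>. case (zeta M s \<alpha>, zeta N u \<alpha>) of
                  (Step s' p, Step u' q) \<Rightarrow>
                    if p = q then equiv_gen rep merge isd kd atoms M N s' u' \<sigma> else return True \<sigma>
                | _ \<Rightarrow> return True \<sigma>)) atoms \<sigma>')"

definition equiv_trace ::
  "('d \<Rightarrow> 's + 'u \<Rightarrow> 's + 'u) \<Rightarrow> ('d \<Rightarrow> 's + 'u \<Rightarrow> 's + 'u \<Rightarrow> 'd) \<Rightarrow>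
   't atom list \<Rightarrow> ('t, 's, 'p) gkat \<Rightarrow> ('t, 'u, 'p) gkat \<Rightarrow> 's \<Rightarrow> 'u \<Rightarrow> ('d, 's + 'u) mem comp" where
  "equiv_trace rep merge atoms M N =
     equiv_gen rep merge (is_dead atoms (sum_zeta M N)) known_dead atoms M N"

definition equiv_inf_trace ::
  "('d \<Rightarrow> 's + 'u \<Rightarrow> 's + 'u) \<Rightarrow> ('d \<Rightarrow> 's + 'u \<Rightarrow> 's + 'u \<Rightarrow> 'd) \<Rightarrow>
   't atom list \<Rightarrow> ('t, 's, 'p) gkat \<Rightarrow> ('t, 'u, 'p) gkat \<Rightarrow> 's \<Rightarrow> 'u \<Rightarrow> ('d, 's + 'u) mem comp" where
  "equiv_inf_trace rep merge atoms M N =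
     equiv_gen rep merge (\<lambda>x. return False) (\<lambda>x \<sigma>. False) atoms M N"

end

theory Submission
  imports Defs
begin

text \<open>Write \<open>R\<close> for the equivalence relation held by the union-find object.  Every call that does
  not return immediately enlarges \<open>R\<close>, which bounds the recursion.  A call returning true only adds
  pairs whose successors are matched by the final \<open>R\<close>, up to dead states.  So the final \<open>R\<close> is
  generated, as an equivalence relation, by pairs that progress into \<open>R\<close>: it preserves words of
  length \<open>n + 1\<close> if it preserves words of length \<open>n\<close>, and it is a bisimulation up to equivalence if
  no state counts as dead.  Conversely, trace equivalence and bisimilarity satisfy all the tests
  performed on a pair, so a test that fails refutes them.  The two parts are instances of a single
  argument about an abstract set of dead states.\<close>

section \<open>Traces and dead states\<close>

inductive_cases is_trace_cases: "is_trace T M s w"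

lemma is_trace_single_iff:
  "is_trace T M s [Inl \<alpha>] \<longleftrightarrow> \<alpha> \<in> At T \<and> zeta M s \<alpha> = Accept"
  by (auto elim: is_trace_cases intro: is_trace.intros)

lemma is_trace_step_iff:
  "is_trace T M s (Inl \<alpha> # Inr p # w) \<longleftrightarrow>
     \<alpha> \<in> At T \<and> (\<exists>s'. zeta M s \<alpha> = Step s' p \<and> is_trace T M s' w)"
  by (auto elim: is_trace_cases intro: is_trace.intros)

text \<open>A trace runs along a path to an accepting state, and such a path, read backwards from
  its end, spells a trace. In this form deadness depends on the trace semantics alone.\<close>

lemma dead_iff_no_trace: "dead T M s \<longleftrightarrow> (\<forall>w. \<not> is_trace T M s w)"
proof
  have "\<exists>s'. (transition T M)\<^sup>*\<^sup>* s s' \<and> (\<exists>\<alpha>\<in>At T. zeta M s' \<alpha> = Accept)"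
    if "is_trace T M s w" for w
    using that
  proof induction
    case (accept \<alpha> s)
    then show ?case by blast
  next
    case (step \<alpha> s s' p w)
    then have "transition T M s s'" by (auto simp: transition_def)
    with step.IH show ?case by (meson converse_rtranclp_into_rtranclp)
  qed
  then show "dead T M s \<Longrightarrow> \<forall>w. \<not> is_trace T M s w"
    unfolding dead_def by blast
next
  have "\<exists>w. is_trace T M s w"
    if "(transition T M)\<^sup>*\<^sup>* s s'" "\<alpha> \<in> At T" "zeta M s' \<alpha> = Accept" for s' \<alpha>
    using that
  proof (induction rule: converse_rtranclp_induct)
    case base
    then show ?case by (blast intro: is_trace.accept)
  next
    case (step x y)
    then show ?case by (auto simp: transition_def intro: is_trace.step)
  qed
  then show "\<forall>w. \<not> is_trace T M s w \<Longrightarrow> dead T M s"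
    unfolding dead_def by blast
qed

lemma dead_iff_traces: "dead T M s \<longleftrightarrow> traces T M s = {}"
  by (simp add: dead_iff_no_trace traces_def)

text \<open>The map \<open>f\<close> commutes with \<open>zeta\<close>, and
  \<open>map_outcome\<close> keeps the constructor, so every step of a trace can be lifted or
  projected. It is meant for the two injections into the sum automaton.\<close>

lemma is_trace_hom:
  assumes hom: "\<And>x \<alpha>. zeta K (f x) \<alpha> = map_outcome f id (zeta M x \<alpha>)"
  shows "is_trace T K (f x) w \<longleftrightarrow> is_trace T M x w"
proof
  show "is_trace T K (f x) w \<Longrightarrow> is_trace T M x w"
  proof (induction "f x" w arbitrary: x rule: is_trace.induct)
    case (accept \<alpha>)
    then show ?case by (cases "zeta M x \<alpha>") (auto simp: hom intro: is_trace.intros)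
  next
    case (step \<alpha> s' p w)
    then show ?case by (cases "zeta M x \<alpha>") (auto simp: hom intro: is_trace.intros)
  qed
  show "is_trace T M x w \<Longrightarrow> is_trace T K (f x) w"
    by (induction rule: is_trace.induct) (auto simp: hom intro: is_trace.intros)
qed

section \<open>The disjoint sum of two automata\<close>

definition sum_gkat ::
  "('t, 's, 'p) gkat \<Rightarrow> ('t, 'u, 'p) gkat \<Rightarrow> ('t, 's + 'u, 'p) gkat" where
  "sum_gkat M N =
     \<lparr>states = states M <+> states N, start = Inl (start M), zeta = sum_zeta M N\<rparr>"

lemma is_trace_sum_gkat:
  "is_trace T (sum_gkat M N) (Inl s) w \<longleftrightarrow> is_trace T M s w"
  "is_trace T (sum_gkat M N) (Inr u) w \<longleftrightarrow> is_trace T N u w"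
  by (rule is_trace_hom, simp add: sum_gkat_def sum_zeta_def)+

lemma dead_sum_gkat:
  "dead T (sum_gkat M N) (Inl s) \<longleftrightarrow> dead T M s"
  "dead T (sum_gkat M N) (Inr u) \<longleftrightarrow> dead T N u"
  by (simp_all add: dead_iff_no_trace is_trace_sum_gkat)

lemma map_outcome_Step_iff:
  "map_outcome f g a = Step y q \<longleftrightarrow> (\<exists>x p. a = Step x p \<and> y = f x \<and> q = g p)"
  by (cases a) auto

lemma gkat_automaton_sum_gkat:
  assumes "gkat_automaton T \<Sigma> M" "gkat_automaton T \<Sigma> N"
  shows "gkat_automaton T \<Sigma> (sum_gkat M N)"
  unfolding gkat_automaton_def
proof (intro conjI ballI allI impI)
  show "finite (states (sum_gkat M N))" "start (sum_gkat M N) \<in> states (sum_gkat M N)"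
    using assms by (auto simp: gkat_automaton_def sum_gkat_def)
  fix x \<alpha> y p assume "x \<in> states (sum_gkat M N)" "\<alpha> \<in> At T" "zeta (sum_gkat M N) x \<alpha> = Step y p"
  then have "(\<exists>s s'. s \<in> states M \<and> zeta M s \<alpha> = Step s' p \<and> y = Inl s') \<or>
      (\<exists>u u'. u \<in> states N \<and> zeta N u \<alpha> = Step u' p \<and> y = Inr u')"
    by (auto simp: sum_gkat_def sum_zeta_def map_outcome_Step_iff)
  then show "y \<in> states (sum_gkat M N)" "p \<in> \<Sigma>"
    using assms \<open>\<alpha> \<in> At T\<close> unfolding gkat_automaton_def sum_gkat_def by auto
qed

lemma dead_reachable: "dead T M x \<Longrightarrow> (transition T M)\<^sup>*\<^sup>* x y \<Longrightarrow> dead T M y"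
  unfolding dead_def by (meson rtranclp_trans)

section \<open>Depth-first search\<close>

text \<open>Expanding an unvisited node shrinks the unvisited part of the finite set
  \<open>Y\<close>, and dropping a visited node shortens the stack, hence the lexicographic measure.
  By the last hypothesis every edge leaving \<open>visited\<close> ends in \<open>visited\<close> or
  on the stack, so the result is closed once the stack is empty.\<close>

lemma dfs_correct:
  assumes "finite Y" and "\<And>y. y \<in> Y \<Longrightarrow> set (succ y) \<subseteq> Y"
    and "set stack \<subseteq> Y"
    and "\<And>v. v \<in> visited \<Longrightarrow> set (succ v) \<subseteq> visited \<union> set stack"
  shows "\<exists>R. dfs succ visited stack = Some R \<and> visited \<union> set stack \<subseteq> R \<and>
    (\<forall>r\<in>R. set (succ r) \<subseteq> R) \<and>
    (\<forall>r\<in>R. r \<in> visited \<or> (\<exists>x\<in>set stack. (\<lambda>a b. b \<in> set (succ a))\<^sup>*\<^sup>* x r))"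
  using assms(3,4)
proof (induction "(card (Y - visited), length stack)" arbitrary: visited stack
    rule: wf_induct_rule[OF wf_lex_prod[OF wf_less_than wf_less_than], case_names less])
  case less
  show ?case
  proof (cases stack)
    case Nil
    then show ?thesis using less.prems by (subst dfs.simps) auto
  next
    case (Cons x xs)
    show ?thesis
    proof (cases "x \<in> visited")
      case True
      have "\<exists>R. dfs succ visited xs = Some R \<and> visited \<union> set xs \<subseteq> R \<and>
        (\<forall>r\<in>R. set (succ r) \<subseteq> R) \<and>
        (\<forall>r\<in>R. r \<in> visited \<or> (\<exists>x\<in>set xs. (\<lambda>a b. b \<in> set (succ a))\<^sup>*\<^sup>* x r))"
        using less.prems Cons True by (intro less.hyps) auto
      then show ?thesis
        using Cons True by (subst dfs.simps) auto
    next
      case False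
      have "card (Y - insert x visited) < card (Y - visited)"
        using assms(1) less.prems Cons False by (intro psubset_card_mono) auto
      then have "\<exists>R. dfs succ (insert x visited) (succ x @ xs) = Some R \<and>
        insert x visited \<union> set (succ x @ xs) \<subseteq> R \<and>
        (\<forall>r\<in>R. set (succ r) \<subseteq> R) \<and>
        (\<forall>r\<in>R. r \<in> insert x visited \<or>
           (\<exists>x\<in>set (succ x @ xs). (\<lambda>a b. b \<in> set (succ a))\<^sup>*\<^sup>* x r))"
        using less.prems Cons assms(2) by (intro less.hyps) fastforce+
      then obtain R where R: "dfs succ (insert x visited) (succ x @ xs) = Some R"
        "insert x visited \<union> set (succ x @ xs) \<subseteq> R" "\<forall>r\<in>R. set (succ r) \<subseteq> R"
        "\<And>r. r \<in> R \<Longrightarrow> r \<in> insert x visited \<or>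
           (\<exists>x\<in>set (succ x @ xs). (\<lambda>a b. b \<in> set (succ a))\<^sup>*\<^sup>* x r)"
        by blast
      have "r \<in> visited \<or> (\<exists>x\<in>set stack. (\<lambda>a b. b \<in> set (succ a))\<^sup>*\<^sup>* x r)" if "r \<in> R" for r
        using R(4)[OF that] Cons
        by (auto intro: converse_rtranclp_into_rtranclp[of "\<lambda>a b. b \<in> set (succ a)"])
      then show ?thesis
        using Cons False R(1-3) by (subst dfs.simps) auto
    qed
  qed
qed

lemma set_successors:
  "set (successors atoms \<zeta> x) = {y. \<exists>\<alpha>\<in>set atoms. \<exists>p. \<zeta> x \<alpha> = Step y p}"
  using [[simproc del: list_to_set_comprehension]]
  by (induction atoms) (auto simp: successors_def split: outcome.splits)

text \<open>The search result contains \<open>x\<close>, is closed under transitions and holds only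
  reachable states, so it is exactly what \<open>x\<close> reaches. If nothing in it accepts, all of
  it is dead, which keeps the cache sound.\<close>

lemma is_dead_correct:
  assumes K: "gkat_automaton T \<Sigma> K" and atoms: "set atoms = At T"
    and C: "C \<subseteq> {x \<in> states K. dead T K x}" and x: "x \<in> states K"
  shows "\<exists>C'. C' \<subseteq> {x \<in> states K. dead T K x} \<and>
    is_dead atoms (zeta K) x (d, C) = Some (dead T K x, (d, C'))"
proof (cases "x \<in> C")
  case True
  then show ?thesis using C by (auto simp: is_dead_def)
next
  case False
  let ?succ = "successors atoms (zeta K)"
  have succ: "(\<lambda>a b. b \<in> set (?succ a)) = transition T K"
    by (auto simp: set_successors transition_def atoms fun_eq_iff)
  have closed: "set (?succ y) \<subseteq> states K" if "y \<in> states K" for y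
    using K that by (auto simp: set_successors atoms gkat_automaton_def)
  have "finite (states K)" using K by (simp add: gkat_automaton_def)
  from dfs_correct[of "states K" ?succ "[x]" "{}", OF this closed]
  obtain R where R: "dfs ?succ {} [x] = Some R" "x \<in> R" "\<forall>r\<in>R. set (?succ r) \<subseteq> R"
    "\<forall>r\<in>R. (transition T K)\<^sup>*\<^sup>* x r"
    using x by (auto simp: succ)
  have "y \<in> R" if "(transition T K)\<^sup>*\<^sup>* x y" for y
    using that
  proof induction
    case base
    show ?case by (rule R(2))
  next
    case (step y z)
    then show ?case using R(3) succ[THEN fun_cong, THEN fun_cong, of z y] by blast
  qed
  then have dead: "dead T K x \<longleftrightarrow> \<not> (\<exists>y\<in>R. \<exists>\<alpha>\<in>set atoms. zeta K y \<alpha> = Accept)"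
    using R(4) by (auto simp: dead_def atoms)
  have states: "y \<in> states K" if "(transition T K)\<^sup>*\<^sup>* x y" for y
    using that x closed
    by induction (auto simp: succ[symmetric])
  show ?thesis
  proof (cases "dead T K x")
    case True
    then have "R \<subseteq> {x \<in> states K. dead T K x}"
      using R(4) states dead_reachable by fast
    then show ?thesis
      using C True False dead by (auto simp: is_dead_def R(1))
  next
    case nd: False
    then show ?thesis
      using C False dead by (auto simp: is_dead_def R(1))
  qed
qed

section \<open>Correctness of the algorithm for an abstract notion of dead state\<close>

text \<open>Tests (i) to (v) at one atom: \<open>P\<close> and \<open>Q\<close> stand for ISDEAD on
  the two sides, \<open>V\<close> for the recursive call. With \<open>V\<close> as a parameter, one
  predicate serves the union-find relation, the equivalence to be decided and bisimulations.\<close>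

fun matches :: "('x \<Rightarrow> bool) \<Rightarrow> ('y \<Rightarrow> bool) \<Rightarrow> ('x \<Rightarrow> 'y \<Rightarrow> bool) \<Rightarrow>
    ('x, 'p) outcome \<Rightarrow> ('y, 'p) outcome \<Rightarrow> bool" where
  "matches P Q V Accept Accept = True"
| "matches P Q V Accept _ = False"
| "matches P Q V _ Accept = False"
| "matches P Q V Reject Reject = True"
| "matches P Q V (Step x p) Reject = P x"
| "matches P Q V Reject (Step y q) = Q y"
| "matches P Q V (Step x p) (Step y q) = (if p = q then V x y else P x \<and> Q y)"

lemma matches_mono:
  "matches P Q V a b \<Longrightarrow> (\<And>x y. V x y \<Longrightarrow> V' x y) \<Longrightarrow> matches P Q V' a b"
  by (cases "(P, Q, V, a, b)" rule: matches.cases) (auto split: if_splits)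

text \<open>\<open>D\<close> is the set of states that ISDEAD recognizes, \<open>I\<close> an invariant of the cache, and \<open>W\<close> the
  equivalence to be decided.\<close>

locale equiv_run = union_find "states M <+> states N" ok fresh rep merge
  for M :: "('t, 's, 'p) gkat" and N :: "('t, 'u, 'p) gkat"
    and ok :: "'d \<Rightarrow> bool" and fresh rep merge +
  fixes T :: "'t set" and \<Sigma> :: "'p set" and atoms :: "'t atom list"
    and isd :: "'s + 'u \<Rightarrow> ('d, 's + 'u) mem comp"
    and kd :: "'s + 'u \<Rightarrow> ('d, 's + 'u) mem \<Rightarrow> bool"
    and I :: "('s + 'u) set \<Rightarrow> bool"
    and D :: "'s + 'u \<Rightarrow> bool"
    and W :: "'s \<Rightarrow> 'u \<Rightarrow> bool"
  assumes M: "gkat_automaton T \<Sigma> M" and N: "gkat_automaton T \<Sigma> N"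
    and atoms: "set atoms = At T"
    and isd: "I C \<Longrightarrow> x \<in> states M <+> states N \<Longrightarrow>
      \<exists>C'. I C' \<and> isd x (d, C) = Some (D x, (d, C'))"
    and kd: "I C \<Longrightarrow> kd x (d, C) \<Longrightarrow> D x"
    and W_dead: "W s u \<Longrightarrow> D (Inl s) \<longleftrightarrow> D (Inr u)"
    and W_matches: "W s u \<Longrightarrow> \<alpha> \<in> At T \<Longrightarrow>
      matches (\<lambda>x. D (Inl x)) (\<lambda>y. D (Inr y)) W (zeta M s \<alpha>) (zeta N u \<alpha>)"
begin

text \<open>Cut down to the carrier, where the union-find laws apply and where finiteness makes the
  number of missing pairs a termination measure.\<close>

definition classes :: "('d, 's + 'u) mem \<Rightarrow> ('s + 'u) rel" where
  "classes \<sigma> = {(x, y). x \<in> states M <+> states N \<and> y \<in> states M <+> states N \<and>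
     rep (fst \<sigma>) x = rep (fst \<sigma>) y}"

definition matched :: "('s + 'u) rel \<Rightarrow> 's \<Rightarrow> 'u \<Rightarrow> 't atom \<Rightarrow> bool" where
  "matched R x y \<alpha> \<longleftrightarrow> matches (\<lambda>x. D (Inl x)) (\<lambda>y. D (Inr y)) (\<lambda>x y. (Inl x, Inr y) \<in> R)
     (zeta M x \<alpha>) (zeta N y \<alpha>)"

definition progress :: "('s + 'u) rel \<Rightarrow> ('s + 'u) rel" where
  "progress R = {(Inl x, Inr y) |x y. x \<in> states M \<and> y \<in> states N \<and>
     (D (Inl x) \<and> D (Inr y) \<or> (\<forall>\<alpha>\<in>At T. matched R x y \<alpha>))}"

definition valid :: "('d, 's + 'u) mem \<Rightarrow> bool" where
  "valid \<sigma> \<longleftrightarrow> ok (fst \<sigma>) \<and> I (snd \<sigma>)"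

text \<open>The last conjunct says that \<open>classes \<sigma>'\<close> lies in the equivalence relation generated by
  \<open>classes \<sigma>\<close> and the pairs that progress into \<open>classes \<sigma>'\<close>.\<close>

definition extends :: "('d, 's + 'u) mem \<Rightarrow> ('d, 's + 'u) mem \<Rightarrow> bool" where
  "extends \<sigma> \<sigma>' \<longleftrightarrow> valid \<sigma>' \<and> classes \<sigma> \<subseteq> classes \<sigma>' \<and>
     (\<forall>E. sym E \<longrightarrow> trans E \<longrightarrow> classes \<sigma> \<subseteq> E \<longrightarrow> progress (classes \<sigma>') \<subseteq> E \<longrightarrow> classes \<sigma>' \<subseteq> E)"

text \<open>A total correctness triple. After false only the state-independent fact \<open>F\<close>
  is kept, since short-circuiting then ends the whole run.\<close>

definition spec :: "(('s + 'u) rel \<Rightarrow> bool) \<Rightarrow> bool \<Rightarrow> ('d, 's + 'u) mem comp \<Rightarrow>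
    ('d, 's + 'u) mem \<Rightarrow> bool" where
  "spec Q F c \<sigma> \<longleftrightarrow>
     (\<exists>b \<sigma>'. c \<sigma> = Some (b, \<sigma>') \<and> (if b then extends \<sigma> \<sigma>' \<and> Q (classes \<sigma>') else F))"

section \<open>Monotonicity and the rules for composing specifications\<close>

lemma matched_mono: "matched R x y \<alpha> \<Longrightarrow> R \<subseteq> R' \<Longrightarrow> matched R' x y \<alpha>"
  unfolding matched_def by (erule matches_mono) auto

lemma progress_mono: "R \<subseteq> R' \<Longrightarrow> progress R \<subseteq> progress R'"
  unfolding progress_def using matched_mono by blast

lemma extends_refl: "valid \<sigma> \<Longrightarrow> extends \<sigma> \<sigma>"
  by (auto simp: extends_def)

text \<open>Pairs that progress into the intermediate relation also progress into the larger final
  one, so a candidate \<open>E\<close> for the final relation contains first the intermediate and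
  then the final relation.\<close>

lemma extends_trans:
  assumes "extends \<sigma> \<sigma>'" "extends \<sigma>' \<sigma>''"
  shows "extends \<sigma> \<sigma>''"
proof -
  have "progress (classes \<sigma>') \<subseteq> progress (classes \<sigma>'')"
    using assms(2) by (intro progress_mono) (simp add: extends_def)
  then show ?thesis
    using assms unfolding extends_def by (meson subset_trans)
qed

lemma spec_mono:
  "spec Q F c \<sigma> \<Longrightarrow> (\<And>R. Q R \<Longrightarrow> Q' R) \<Longrightarrow> (F \<Longrightarrow> F') \<Longrightarrow> spec Q' F' c \<sigma>"
  unfolding spec_def by (elim exE conjE, intro exI conjI, assumption) (auto split: if_splits)

lemma spec_return:
  "valid \<sigma> \<Longrightarrow> (b \<Longrightarrow> Q (classes \<sigma>)) \<Longrightarrow> (\<not> b \<Longrightarrow> F) \<Longrightarrow> spec Q F (return b) \<sigma>"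
  by (auto simp: spec_def return_def extends_refl)

text \<open>ISDEAD changes only the cache, so \<open>classes\<close> stays as it is.\<close>

lemma spec_isd:
  assumes "valid \<sigma>" "x \<in> states M <+> states N" "\<not> D x \<Longrightarrow> F" "\<And>R. D x \<Longrightarrow> Q R"
  shows "spec Q F (isd x) \<sigma>"
proof -
  obtain C' where "I C'" "isd x \<sigma> = Some (D x, (fst \<sigma>, C'))"
    using isd[of "snd \<sigma>" x "fst \<sigma>"] assms(1,2) by (auto simp: valid_def)
  then show ?thesis
    using assms by (auto simp: spec_def extends_def valid_def classes_def)
qed

text \<open>What \<open>c\<close> establishes about the intermediate relation must survive the
  merges made by \<open>c'\<close>, hence the monotonicity of \<open>Q\<close>.\<close>

lemma spec_conj_then:
  assumes c: "spec Q F c \<sigma>" and c': "\<And>\<sigma>'. extends \<sigma> \<sigma>' \<Longrightarrow> spec Q' F c' \<sigma>'"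
    and mono: "\<And>R R'. Q R \<Longrightarrow> R \<subseteq> R' \<Longrightarrow> Q R'"
    and conseq: "\<And>R. Q R \<Longrightarrow> Q' R \<Longrightarrow> Q'' R"
  shows "spec Q'' F (c &&&& c') \<sigma>"
proof -
  obtain b \<sigma>' where *: "c \<sigma> = Some (b, \<sigma>')" "if b then extends \<sigma> \<sigma>' \<and> Q (classes \<sigma>') else F"
    using c by (auto simp: spec_def)
  show ?thesis
  proof (cases b)
    case False
    then show ?thesis using * by (auto simp: spec_def conj_then_def)
  next
    case True
    with * have ext: "extends \<sigma> \<sigma>'" and Q: "Q (classes \<sigma>')" by auto
    obtain b' \<sigma>'' where **: "c' \<sigma>' = Some (b', \<sigma>'')"
      "if b' then extends \<sigma>' \<sigma>'' \<and> Q' (classes \<sigma>'') else F"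
      using c'[OF ext] by (auto simp: spec_def)
    have "extends \<sigma> \<sigma>'' \<and> Q'' (classes \<sigma>'')" if b'
      using that ** extends_trans[OF ext, of \<sigma>''] mono[OF Q, of "classes \<sigma>''"] conseq
      by (auto simp: extends_def)
    then show ?thesis
      using True * ** by (auto simp: spec_def conj_then_def)
  qed
qed

text \<open>An atom is processed only after earlier ones have changed the state, so its
  specification is required from every extension of \<sigma>; this also lets the induction move its
  starting state.\<close>

lemma spec_conj_all:
  assumes "valid \<sigma>"
    and "\<And>\<alpha> \<sigma>'. \<alpha> \<in> set xs \<Longrightarrow> extends \<sigma> \<sigma>' \<Longrightarrow> spec (Q \<alpha>) F (f \<alpha>) \<sigma>'"
    and mono: "\<And>\<alpha> R R'. Q \<alpha> R \<Longrightarrow> R \<subseteq> R' \<Longrightarrow> Q \<alpha> R'"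
  shows "spec (\<lambda>R. \<forall>\<alpha>\<in>set xs. Q \<alpha> R) F (conj_all f xs) \<sigma>"
  using assms(1,2)
proof (induction xs arbitrary: \<sigma>)
  case Nil
  then show ?case by (auto intro: spec_return)
next
  case (Cons \<alpha> xs)
  have "spec (\<lambda>R. \<forall>\<alpha>\<in>set xs. Q \<alpha> R) F (conj_all f xs) \<sigma>'" if "extends \<sigma> \<sigma>'" for \<sigma>'
  proof (rule Cons.IH)
    show "valid \<sigma>'" using that by (simp add: extends_def)
    show "spec (Q \<beta>) F (f \<beta>) \<sigma>''" if "\<beta> \<in> set xs" "extends \<sigma>' \<sigma>''" for \<beta> \<sigma>''
      using that extends_trans[OF \<open>extends \<sigma> \<sigma>'\<close>] by (intro Cons.prems(2)) auto
  qed
  moreover have "spec (Q \<alpha>) F (f \<alpha>) \<sigma>"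
    using Cons.prems(1) by (intro Cons.prems(2) extends_refl) auto
  ultimately show ?case
    unfolding conj_all.simps
    by (intro spec_conj_then[where Q = "Q \<alpha>" and Q' = "\<lambda>R. \<forall>\<alpha>\<in>set xs. Q \<alpha> R"])
      (auto intro: mono)
qed

section \<open>Merging two classes\<close>

lemma sym_classes: "sym (classes \<sigma>)" and trans_classes: "trans (classes \<sigma>)"
  by (auto simp: classes_def sym_def trans_def)

text \<open>Together the three parts say that a merge yields the least equivalence on the carrier
  containing the old relation and the new pair. Reflexivity of \<open>E\<close> on the carrier comes
  from its containing \<open>classes (d, C)\<close>.\<close>

lemma classes_merge:
  assumes "ok d" "x \<in> states M" "y \<in> states N"
  shows "classes (d, C) \<subseteq> classes (merge d (Inl x) (Inr y), C)"
    and "(Inl x, Inr y) \<in> classes (merge d (Inl x) (Inr y), C)"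
    and "sym E \<Longrightarrow> trans E \<Longrightarrow> classes (d, C) \<subseteq> E \<Longrightarrow> (Inl x, Inr y) \<in> E \<Longrightarrow>
      classes (merge d (Inl x) (Inr y), C) \<subseteq> E"
proof -
  have xy: "Inl x \<in> states M <+> states N" "Inr y \<in> states M <+> states N"
    using assms by auto
  show "classes (d, C) \<subseteq> classes (merge d (Inl x) (Inr y), C)"
    "(Inl x, Inr y) \<in> classes (merge d (Inl x) (Inr y), C)"
    using xy rep_merge[OF assms(1) xy] by (auto simp: classes_def)
  assume E: "sym E" "trans E" "classes (d, C) \<subseteq> E" "(Inl x, Inr y) \<in> E"
  have link: "(a, b) \<in> E" if "(a, Inl x) \<in> E" "(b, Inr y) \<in> E" for a b
    using that E(1,2,4) by (meson symD transD)
  show "classes (merge d (Inl x) (Inr y), C) \<subseteq> E"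
  proof
    fix p assume "p \<in> classes (merge d (Inl x) (Inr y), C)"
    then obtain a b where p: "p = (a, b)" "a \<in> states M <+> states N" "b \<in> states M <+> states N"
      "rep (merge d (Inl x) (Inr y)) a = rep (merge d (Inl x) (Inr y)) b"
      by (auto simp: classes_def)
    have in_E: "(v, w) \<in> E"
      if "rep d v = rep d w" "v \<in> states M <+> states N" "w \<in> states M <+> states N" for v w
      using that E(3) by (auto simp: classes_def)
    from p(4) consider "rep d a = rep d b"
      | "rep d a = rep d (Inl x)" "rep d b = rep d (Inr y)"
      | "rep d a = rep d (Inr y)" "rep d b = rep d (Inl x)"
      using rep_merge[OF assms(1) xy p(2,3)] by blast
    then have "(a, b) \<in> E"
    proof cases
      case 1
      then show ?thesis using in_E p by blast
    next
      case 2
      then show ?thesis using in_E p xy link by blast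
    next
      case 3
      then show ?thesis using in_E p xy link E(1) by (meson symD)
    qed
    then show "p \<in> E" using p(1) by simp
  qed
qed

text \<open>The pair is merged on credit, before it has been tested. The debt is paid at the end:
  once the pair progresses into the final relation it is itself one of the allowed generators, so
  any admissible \<open>E\<close> contains it and hence the merged relation.\<close>

lemma extends_merge:
  assumes "ok d" "x \<in> states M" "y \<in> states N"
    and "extends (merge d (Inl x) (Inr y), C) \<sigma>'" "(Inl x, Inr y) \<in> progress (classes \<sigma>')"
  shows "extends (d, C) \<sigma>'"
proof -
  note merge = classes_merge[OF assms(1-3), where C = C]
  have "classes \<sigma>' \<subseteq> E"
    if E: "sym E" "trans E" "classes (d, C) \<subseteq> E" "progress (classes \<sigma>') \<subseteq> E" for E
  proof -
    have "classes (merge d (Inl x) (Inr y), C) \<subseteq> E"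
      using merge(3)[OF E(1-3)] E(4) assms(5) by blast
    then show ?thesis using assms(4) E unfolding extends_def by blast
  qed
  then show ?thesis
    using assms(4) merge(1) unfolding extends_def by blast
qed

section \<open>Correctness of the recursive calls\<close>

lemma finite_states: "finite (states M <+> states N)"
  using M N by (simp add: gkat_automaton_def)

lemma closed:
  "s \<in> states M \<Longrightarrow> \<alpha> \<in> At T \<Longrightarrow> zeta M s \<alpha> = Step s' p \<Longrightarrow> s' \<in> states M"
  "u \<in> states N \<Longrightarrow> \<alpha> \<in> At T \<Longrightarrow> zeta N u \<alpha> = Step u' p \<Longrightarrow> u' \<in> states N"
  using M N by (auto simp: gkat_automaton_def)

abbreviation run where "run \<equiv> equiv_gen rep merge isd kd atoms M N"

text \<open>Induction on the number of pairs not yet related. Termination, the generation property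
  after true and the refutation of \<open>W\<close> after false are proved together, since the
  behaviour of each test depends on the state left by earlier ones.\<close>

lemma run_spec:
  assumes "valid \<sigma>" "s \<in> states M" "u \<in> states N"
  shows "spec (\<lambda>R. (Inl s, Inr u) \<in> R) (\<not> W s u) (run s u) \<sigma>"
  using assms
proof (induction "card ((states M <+> states N) \<times> (states M <+> states N) - classes \<sigma>)"
    arbitrary: \<sigma> s u rule: less_induct)
  case less
  note su = less.prems(2,3)
  show ?case
  proof (cases "rep (fst \<sigma>) (Inl s) = rep (fst \<sigma>) (Inr u)")
    case True
    then have "run s u \<sigma> = return True \<sigma>" by (subst equiv_gen.simps) simp
    with True su less.prems(1) show ?thesis
      by (auto simp: spec_def return_def classes_def extends_refl)
  next
    case False
    obtain d C where \<sigma>: "\<sigma> = (d, C)" by fastforce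
    define \<sigma>m where "\<sigma>m = (merge d (Inl s) (Inr u), C)"
    have ok: "ok d" and "I C" using less.prems(1) by (auto simp: \<sigma> valid_def)
    with su have valid: "valid \<sigma>m" by (auto simp: \<sigma>m_def valid_def intro: ok_merge)
    note merge = classes_merge[OF ok su, where C = C, folded \<sigma>m_def \<sigma>]
    \<comment> \<open>Recursive calls start from arbitrary extensions of \<open>\<sigma>m\<close>,
      as earlier atoms may have merged further classes. The newly merged pair makes the decrease
      strict.\<close>
    have decreasing: "card ((states M <+> states N) \<times> (states M <+> states N) - classes \<sigma>') <
        card ((states M <+> states N) \<times> (states M <+> states N) - classes \<sigma>)"
      if "extends \<sigma>m \<sigma>'" for \<sigma>'
    proof (rule psubset_card_mono)
      show "finite ((states M <+> states N) \<times> (states M <+> states N) - classes \<sigma>)"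
        using finite_states by simp
      have "(Inl s, Inr u) \<notin> classes \<sigma>" "(Inl s, Inr u) \<in> classes \<sigma>'"
        "classes \<sigma> \<subseteq> classes \<sigma>'"
        using False that merge(1,2) unfolding extends_def by (auto simp: classes_def[of \<sigma>])
      then show "(states M <+> states N) \<times> (states M <+> states N) - classes \<sigma>'
        \<subset> (states M <+> states N) \<times> (states M <+> states N) - classes \<sigma>"
        using su by auto
    qed
    \<comment> \<open>Every branch reduces to showing that the merged pair progresses into the final
      relation; its membership there is already secured by the merge.\<close>
    have finish: "spec (\<lambda>R. (Inl s, Inr u) \<in> R) (\<not> W s u) (run s u) \<sigma>"
      if run: "run s u \<sigma> = c \<sigma>m"
        and spec: "spec (\<lambda>R. (Inl s, Inr u) \<in> progress R) (\<not> W s u) c \<sigma>m" for c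
    proof -
      obtain b \<sigma>' where c: "c \<sigma>m = Some (b, \<sigma>')"
        "if b then extends \<sigma>m \<sigma>' \<and> (Inl s, Inr u) \<in> progress (classes \<sigma>') else \<not> W s u"
        using spec unfolding spec_def by blast
      have "extends \<sigma> \<sigma>' \<and> (Inl s, Inr u) \<in> classes \<sigma>'" if b
      proof -
        have ext: "extends \<sigma>m \<sigma>'" and prog: "(Inl s, Inr u) \<in> progress (classes \<sigma>')"
          using that c(2) by auto
        have "classes \<sigma>m \<subseteq> classes \<sigma>'"
          using ext by (simp add: extends_def)
        with merge(2) show ?thesis
          using extends_merge[OF ok su ext[unfolded \<sigma>m_def] prog] by (auto simp: \<sigma>)
      qed
      then show ?thesis
        using run c unfolding spec_def by (cases b) auto
    qed
    have kd_D: "D x" if "kd x \<sigma>m" for x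
      using that \<open>I C\<close> kd by (auto simp: \<sigma>m_def)
    show ?thesis
    proof (cases "kd (Inl s) \<sigma>m \<or> kd (Inr u) \<sigma>m")
      \<comment> \<open>One state is known to be dead. If the other is dead too, the pair lies in
        \<open>progress\<close> by its first disjunct; if not, \<open>W_dead\<close> refutes
        \<open>W s u\<close>.\<close>
      case True
      then show ?thesis
      proof (cases "kd (Inl s) \<sigma>m")
        case True
        then have run: "run s u \<sigma> = isd (Inr u) \<sigma>m"
          using False by (subst equiv_gen.simps) (simp add: \<sigma> \<sigma>m_def Let_def)
        then show ?thesis
          using su kd_D[OF True] W_dead[of s u]
          by (intro finish[where c = "isd (Inr u)", OF run] spec_isd[OF valid]) (auto simp: progress_def)
      next
        case F: False
        with \<open>kd (Inl s) \<sigma>m \<or> kd (Inr u) \<sigma>m\<close> have "kd (Inr u) \<sigma>m" by simp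
        with F have run: "run s u \<sigma> = isd (Inl s) \<sigma>m"
          using False by (subst equiv_gen.simps) (simp add: \<sigma> \<sigma>m_def Let_def)
        then show ?thesis
          using su kd_D[OF \<open>kd (Inr u) \<sigma>m\<close>] W_dead[of s u]
          by (intro finish[where c = "isd (Inl s)", OF run] spec_isd[OF valid]) (auto simp: progress_def)
      qed
    next
      case not_kd: False
      define f where "f = (\<lambda>\<alpha>.
               return (zeta M s \<alpha> = Accept \<longleftrightarrow> zeta N u \<alpha> = Accept)
          &&&& (\<lambda>\<sigma>. case (zeta M s \<alpha>, zeta N u \<alpha>) of
                  (Step s' p, Reject) \<Rightarrow> isd (Inl s') \<sigma>
                | _ \<Rightarrow> return True \<sigma>)
          &&&& (\<lambda>\<sigma>. case (zeta M s \<alpha>, zeta N u \<alpha>) of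
                  (Reject, Step u' p) \<Rightarrow> isd (Inr u') \<sigma>
                | _ \<Rightarrow> return True \<sigma>)
          &&&& (\<lambda>\<sigma>. case (zeta M s \<alpha>, zeta N u \<alpha>) of
                  (Step s' p, Step u' q) \<Rightarrow>
                    if p \<noteq> q then (isd (Inl s') &&&& isd (Inr u')) \<sigma> else return True \<sigma>
                | _ \<Rightarrow> return True \<sigma>)
          &&&& (\<lambda>\<sigma>. case (zeta M s \<alpha>, zeta N u \<alpha>) of
                  (Step s' p, Step u' q) \<Rightarrow>
                    if p = q then run s' u' \<sigma> else return True \<sigma>
                | _ \<Rightarrow> return True \<sigma>))"
      have run: "run s u \<sigma> = conj_all f atoms \<sigma>m"
        using False not_kd by (subst equiv_gen.simps) (simp add: \<sigma> \<sigma>m_def Let_def f_def)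
      have "spec (\<lambda>R. matched R s u \<alpha>) (\<not> W s u) (f \<alpha>) \<sigma>1"
        if \<alpha>: "\<alpha> \<in> set atoms" and ext: "extends \<sigma>m \<sigma>1" for \<alpha> \<sigma>1
      proof -
        have \<alpha>: "\<alpha> \<in> At T" using \<alpha> atoms by simp
        have valid1: "valid \<sigma>1" using ext by (simp add: extends_def)
        \<comment> \<open>Once both outcomes at \<alpha> are fixed, these laws collapse the chain of
          five tests to the one that applies.\<close>
        have true_then: "(return True &&&& c) = c"
          and then_true: "(c &&&& return True) = c"
          and false_then: "(return False &&&& c) = return False" for c :: "('d, 's + 'u) mem comp"
          by (auto simp: conj_then_def return_def fun_eq_iff split: Option.bind_splits)
        show ?thesis
        proof (cases "zeta M s \<alpha>")
          case Reject
          show ?thesis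
          proof (cases "zeta N u \<alpha>")
            case R': Reject
            show ?thesis
              using Reject R' valid1
              by (auto simp: f_def true_then matched_def intro!: spec_return)
          next
            case Accept
            show ?thesis
              using Reject Accept valid1 W_matches[of s u, OF _ \<alpha>]
              by (auto simp: f_def false_then intro!: spec_return)
          next
            case (Step u' q)
            show ?thesis
              using Reject Step valid1 W_matches[of s u, OF _ \<alpha>] closed(2)[OF su(2) \<alpha> Step]
              by (auto simp: f_def true_then then_true matched_def intro!: spec_isd)
          qed
        next
          case Accept
          show ?thesis
            using Accept valid1 W_matches[of s u, OF _ \<alpha>]
            by (cases "zeta N u \<alpha>")
              (auto simp: f_def true_then false_then matched_def intro!: spec_return)
        next
          case (Step s' p)
          have s': "s' \<in> states M" by (rule closed(1)[OF su(1) \<alpha> Step])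
          show ?thesis
          proof (cases "zeta N u \<alpha>")
            case Reject
            show ?thesis
              using Reject Step valid1 s' W_matches[of s u, OF _ \<alpha>]
              by (auto simp: f_def true_then then_true matched_def intro!: spec_isd)
          next
            case Accept
            show ?thesis
              using Accept Step valid1 W_matches[of s u, OF _ \<alpha>]
              by (auto simp: f_def false_then intro!: spec_return)
          next
            case S': (Step u' q)
            have u': "u' \<in> states N" by (rule closed(2)[OF su(2) \<alpha> S'])
            show ?thesis
            proof (cases "p = q")
              case True
              \<comment> \<open>A failing recursive call refutes \<open>W s' u'\<close>, and
                \<open>W_matches\<close> carries this back to \<open>W s u\<close>.\<close>
              have "spec (\<lambda>R. (Inl s', Inr u') \<in> R) (\<not> W s' u') (run s' u') \<sigma>1"
                using less.hyps[OF decreasing[OF ext] valid1 s' u'] .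
              moreover have "f \<alpha> = run s' u'"
                using True Step S' by (simp add: f_def true_then)
              ultimately show ?thesis
                using True Step S' W_matches[of s u, OF _ \<alpha>]
                by (auto simp: matched_def elim!: spec_mono)
            next
              case pq: False
              have "f \<alpha> = (isd (Inl s') &&&& isd (Inr u'))"
                using Step S' pq by (simp add: f_def true_then then_true)
              moreover have "spec (\<lambda>R. matched R s u \<alpha>) (\<not> W s u)
                (isd (Inl s') &&&& isd (Inr u')) \<sigma>1"
              proof (rule spec_conj_then[where Q = "\<lambda>_. D (Inl s')" and Q' = "\<lambda>_. D (Inr u')"])
                have W: "D (Inl s') \<and> D (Inr u')" if "W s u"
                  using W_matches[OF that \<alpha>] pq Step S' by simp
                show "spec (\<lambda>_. D (Inl s')) (\<not> W s u) (isd (Inl s')) \<sigma>1"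
                  using s' W by (intro spec_isd[OF valid1]) auto
                show "spec (\<lambda>_. D (Inr u')) (\<not> W s u) (isd (Inr u')) \<sigma>2" if "extends \<sigma>1 \<sigma>2" for \<sigma>2
                  using that u' W by (intro spec_isd) (auto simp: extends_def)
                show "matched R s u \<alpha>" if "D (Inl s')" "D (Inr u')" for R
                  using that pq Step S' by (simp add: matched_def)
              qed
              ultimately show ?thesis by simp
            qed
          qed
        qed
      qed
      then have "spec (\<lambda>R. \<forall>\<alpha>\<in>set atoms. matched R s u \<alpha>) (\<not> W s u) (conj_all f atoms) \<sigma>m"
        using matched_mono by (rule spec_conj_all[where Q = "\<lambda>\<alpha> R. matched R s u \<alpha>", OF valid])
      then show ?thesis
        using su by (intro finish[where c = "conj_all f atoms", OF run])
          (auto simp: progress_def atoms elim!: spec_mono)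
    qed
  qed
qed

text \<open>Completeness is contained in \<open>run_spec\<close>. For soundness the fresh classes
  are the identity, so what remains is an equivalence generated by pairs that progress into it, and
  \<open>sound\<close> treats such a relation without reference to the run.\<close>

lemma run_correct:
  assumes "I C" "s \<in> states M" "u \<in> states N"
    and sound: "\<And>R. sym R \<Longrightarrow> trans R \<Longrightarrow> Id_on (states M <+> states N) \<subseteq> R \<Longrightarrow>
      (\<And>E. sym E \<Longrightarrow> trans E \<Longrightarrow> Id_on (states M <+> states N) \<subseteq> E \<Longrightarrow> progress R \<subseteq> E \<Longrightarrow> R \<subseteq> E) \<Longrightarrow>
      (Inl s, Inr u) \<in> R \<Longrightarrow> W s u"
  shows "\<exists>b \<sigma>. run s u (fresh, C) = Some (b, \<sigma>) \<and> (b \<longleftrightarrow> W s u)"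
proof -
  have "valid (fresh, C)" using assms(1) ok_fresh by (simp add: valid_def)
  from run_spec[OF this assms(2,3)] obtain b \<sigma>
    where *: "run s u (fresh, C) = Some (b, \<sigma>)"
      "if b then extends (fresh, C) \<sigma> \<and> (Inl s, Inr u) \<in> classes \<sigma> else \<not> W s u"
    by (auto simp: spec_def)
  have "classes (fresh, C) = Id_on (states M <+> states N)"
    using rep_fresh by (auto simp: classes_def Id_on_def)
  then have "W s u" if b
    using that * sound[of "classes \<sigma>"] sym_classes trans_classes by (simp add: extends_def)
  with * show ?thesis by (cases b) auto
qed

end

section \<open>Trace equivalence and bisimilarity\<close>

text \<open>Compare words beginning with \<alpha>. If one side rejects or the actions differ, no
  word through a step on one side belongs to the other side, so the successors have no traces and
  are dead.\<close>

lemma trace_matches: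
  assumes "traces T M s = traces T N u" "\<alpha> \<in> At T"
  shows "matches (dead T M) (dead T N) (\<lambda>x y. traces T M x = traces T N y)
    (zeta M s \<alpha>) (zeta N u \<alpha>)"
proof -
  have eq: "is_trace T M s w \<longleftrightarrow> is_trace T N u w" for w
    using assms(1) by (auto simp: traces_def)
  show ?thesis
    using eq[of "[Inl \<alpha>]"] eq[of "Inl \<alpha> # Inr _ # _"] assms(2)
    by (cases "zeta M s \<alpha>"; cases "zeta N u \<alpha>")
      (auto simp: is_trace_single_iff is_trace_step_iff dead_iff_no_trace traces_def)
qed

text \<open>A step consumes an atom and an action, so a remaining word fits the bound
  \<open>n\<close> with room to spare; dead successors contribute no words.\<close>

lemma matches_trace:
  assumes "\<And>\<alpha>. \<alpha> \<in> At T \<Longrightarrow> matches (dead T M) (dead T N)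
      (\<lambda>x y. \<forall>w. length w \<le> n \<longrightarrow> (is_trace T M x w \<longleftrightarrow> is_trace T N y w)) (zeta M s \<alpha>) (zeta N u \<alpha>)"
    and "length w \<le> Suc n"
  shows "is_trace T M s w \<longleftrightarrow> is_trace T N u w"
proof
  assume "is_trace T M s w"
  then show "is_trace T N u w"
  proof cases
    case (accept \<alpha>)
    then show ?thesis
      using assms(1)[of \<alpha>] by (cases "zeta N u \<alpha>") (auto intro: is_trace.intros)
  next
    case (step \<alpha> s' p w')
    then show ?thesis
      using assms(1)[of \<alpha>] assms(2)
      by (cases "zeta N u \<alpha>") (auto simp: dead_iff_no_trace intro: is_trace.intros split: if_splits)
  qed
next
  assume "is_trace T N u w"
  then show "is_trace T M s w"
  proof cases
    case (accept \<alpha>)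
    then show ?thesis
      using assms(1)[of \<alpha>] by (cases "zeta M s \<alpha>") (auto intro: is_trace.intros)
  next
    case (step \<alpha> u' p w')
    then show ?thesis
      using assms(1)[of \<alpha>] assms(2)
      by (cases "zeta M s \<alpha>") (auto simp: dead_iff_no_trace intro: is_trace.intros split: if_splits)
  qed
qed

lemma bisimilar_matches:
  assumes "bisimilar T M N s u" "\<alpha> \<in> At T"
  shows "matches (\<lambda>_. False) (\<lambda>_. False) (bisimilar T M N) (zeta M s \<alpha>) (zeta N u \<alpha>)"
proof -
  obtain B where B: "bisimulation T M N B" "(s, u) \<in> B"
    using assms(1) by (auto simp: bisimilar_def)
  then have "(zeta M s \<alpha> = Accept \<and> zeta N u \<alpha> = Accept) \<or>
      (zeta M s \<alpha> = Reject \<and> zeta N u \<alpha> = Reject) \<or>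
      (\<exists>p x' y'. zeta M s \<alpha> = Step x' p \<and> zeta N u \<alpha> = Step y' p \<and> (x', y') \<in> B)"
    using assms(2) unfolding bisimulation_def by fast
  with B(1) show ?thesis by (auto simp: bisimilar_def)
qed

lemma matches_bisimulation:
  assumes "B \<subseteq> states M \<times> states N"
    and "\<And>x y \<alpha>. (x, y) \<in> B \<Longrightarrow> \<alpha> \<in> At T \<Longrightarrow>
      matches (\<lambda>_. False) (\<lambda>_. False) (\<lambda>x y. (x, y) \<in> B) (zeta M x \<alpha>) (zeta N y \<alpha>)"
  shows "bisimulation T M N B"
proof -
  have "zeta M x \<alpha> = Accept \<and> zeta N y \<alpha> = Accept \<or>
      zeta M x \<alpha> = Reject \<and> zeta N y \<alpha> = Reject \<or>
      (\<exists>p x' y'. zeta M x \<alpha> = Step x' p \<and> zeta N y \<alpha> = Step y' p \<and> (x', y') \<in> B)"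
    if "(x, y) \<in> B" "\<alpha> \<in> At T" for x y \<alpha>
    using assms(2)[OF that]
    by (cases "zeta M x \<alpha>"; cases "zeta N y \<alpha>") (auto split: if_splits)
  then show ?thesis
    using assms(1) unfolding bisimulation_def by fast
qed

lemma equiv_trace_correct:
  fixes M :: "('t, 's, 'p) gkat" and N :: "('t, 'u, 'p) gkat"
    and ok :: "'d \<Rightarrow> bool"
  assumes M: "gkat_automaton T \<Sigma> M" and N: "gkat_automaton T \<Sigma> N"
    and s: "s \<in> states M" and u: "u \<in> states N" and atoms: "set atoms = At T"
    and uf: "union_find (states M <+> states N) ok fresh rep merge"
    and C: "C \<subseteq> {x \<in> states M. dead T M x} <+> {y \<in> states N. dead T N y}"
  shows "\<exists>b \<sigma>. equiv_trace rep merge atoms M N s u (fresh, C) = Some (b, \<sigma>) \<and>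
    (b \<longleftrightarrow> traces T M s = traces T N u)"
proof -
  let ?K = "sum_gkat M N"
  let ?X = "states M <+> states N"
  have K: "states ?K = ?X" "zeta ?K = sum_zeta M N"
    by (simp_all add: sum_gkat_def)
  interpret equiv_run M N ok fresh rep merge T \<Sigma> atoms
    "is_dead atoms (sum_zeta M N)" known_dead
    "\<lambda>C. C \<subseteq> {x \<in> ?X. dead T ?K x}" "dead T ?K" "\<lambda>s u. traces T M s = traces T N u"
  proof (intro equiv_run.intro[OF uf] equiv_run_axioms.intro)
    show "\<exists>C'. C' \<subseteq> {x \<in> ?X. dead T ?K x} \<and>
        is_dead atoms (sum_zeta M N) x (d, C) = Some (dead T ?K x, d, C')"
      if "C \<subseteq> {x \<in> ?X. dead T ?K x}" "x \<in> ?X" for C x and d :: 'd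
      using is_dead_correct[OF gkat_automaton_sum_gkat[OF M N] atoms, of C x d] that
      by (simp add: K)
    show "dead T ?K x" if "C \<subseteq> {x \<in> ?X. dead T ?K x}" "known_dead x (d, C)" for C x and d :: 'd
      using that by (auto simp: known_dead_def)
    show "dead T ?K (Inl s) \<longleftrightarrow> dead T ?K (Inr u)" if "traces T M s = traces T N u" for s u
      using that unfolding dead_sum_gkat by (simp add: dead_iff_traces)
    show "matches (\<lambda>x. dead T ?K (Inl x)) (\<lambda>y. dead T ?K (Inr y))
        (\<lambda>s u. traces T M s = traces T N u) (zeta M s \<alpha>) (zeta N u \<alpha>)"
      if "traces T M s = traces T N u" "\<alpha> \<in> At T" for s u \<alpha>
      using trace_matches[OF that] by (simp add: dead_sum_gkat)
  qed (rule M N atoms)+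
  show ?thesis
    unfolding equiv_trace_def
  proof (rule run_correct[OF _ s u])
    show "C \<subseteq> {x \<in> ?X. dead T ?K x}"
      using C by (auto simp: dead_sum_gkat)
    fix R assume R: "\<And>E. sym E \<Longrightarrow> trans E \<Longrightarrow> Id_on ?X \<subseteq> E \<Longrightarrow> progress R \<subseteq> E \<Longrightarrow> R \<subseteq> E"
      and su: "(Inl s, Inr u) \<in> R"
    \<comment> \<open>Agreement on all words is not visibly preserved, because successors of a
      progressing pair are only known to lie in \<open>R\<close>. Bounding the length turns this
      circularity into an induction.\<close>
    have "R \<subseteq> {(x, y). \<forall>w. length w \<le> n \<longrightarrow> (is_trace T ?K x w \<longleftrightarrow> is_trace T ?K y w)}"
      (is "_ \<subseteq> ?E n") for n
    proof (induction n)
      case 0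
      have "\<not> is_trace T ?K x []" for x by (auto elim: is_trace_cases)
      then show ?case by simp
    next
      case (Suc n)
      have "is_trace T M x w \<longleftrightarrow> is_trace T N y w"
        if p: "(Inl x, Inr y) \<in> progress R" and w: "length w \<le> Suc n" for x y w
      proof (cases "dead T M x \<and> dead T N y")
        case True
        then show ?thesis by (simp add: dead_iff_no_trace)
      next
        case False
        have "matches (dead T M) (dead T N)
            (\<lambda>x y. \<forall>w. length w \<le> n \<longrightarrow> (is_trace T M x w \<longleftrightarrow> is_trace T N y w))
            (zeta M x \<alpha>) (zeta N y \<alpha>)" if "\<alpha> \<in> At T" for \<alpha>
        proof (rule matches_mono)
          show "matches (dead T M) (dead T N) (\<lambda>x y. (Inl x, Inr y) \<in> R) (zeta M x \<alpha>) (zeta N y \<alpha>)"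
            using p False that by (auto simp: progress_def matched_def dead_sum_gkat)
        qed (use Suc.IH in \<open>auto simp: is_trace_sum_gkat\<close>)
        then show ?thesis using w by (rule matches_trace)
      qed
      moreover have "\<exists>x y. p = (Inl x, Inr y)" if "p \<in> progress R" for p
        using that by (auto simp: progress_def)
      ultimately have "progress R \<subseteq> ?E (Suc n)"
        by (fastforce simp: is_trace_sum_gkat)
      \<comment> \<open>\<open>?E (Suc n)\<close> is an equivalence containing all generators of
        \<open>R\<close>, hence \<open>R\<close> itself.\<close>
      then show ?case
        by (intro R) (auto simp: sym_def trans_def)
    qed
    then show "traces T M s = traces T N u"
      using su by (fastforce simp: traces_def is_trace_sum_gkat)
  qed
qed

lemma equiv_inf_trace_correct:
  fixes M :: "('t, 's, 'p) gkat" and N :: "('t, 'u, 'p) gkat"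
    and ok :: "'d \<Rightarrow> bool"
  assumes M: "gkat_automaton T \<Sigma> M" and N: "gkat_automaton T \<Sigma> N"
    and s: "s \<in> states M" and u: "u \<in> states N" and atoms: "set atoms = At T"
    and uf: "union_find (states M <+> states N) ok fresh rep merge"
  shows "\<exists>b \<sigma>. equiv_inf_trace rep merge atoms M N s u (fresh, C) = Some (b, \<sigma>) \<and>
    (b \<longleftrightarrow> bisimilar T M N s u)"
proof -
  let ?K = "sum_gkat M N"
  let ?X = "states M <+> states N"
  \<comment> \<open>With ISDEAD constantly false no state counts as dead, and the cache needs no
    invariant.\<close>
  interpret equiv_run M N ok fresh rep merge T \<Sigma> atoms
    "\<lambda>x. return False" "\<lambda>x \<sigma>. False" "\<lambda>C. True" "\<lambda>x. False" "bisimilar T M N"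
    by (intro equiv_run.intro[OF uf] equiv_run_axioms.intro)
      (simp_all add: M N atoms bisimilar_matches return_def)
  show ?thesis
    unfolding equiv_inf_trace_def
  proof (rule run_correct[OF TrueI s u])
    fix R assume sym: "sym R" and trans: "trans R" and refl: "Id_on ?X \<subseteq> R"
      and R: "\<And>E. sym E \<Longrightarrow> trans E \<Longrightarrow> Id_on ?X \<subseteq> E \<Longrightarrow> progress R \<subseteq> E \<Longrightarrow> R \<subseteq> E"
      and su: "(Inl s, Inr u) \<in> R"
    \<comment> \<open>The bisimulation functional applied to \<open>R\<close> on the sum automaton.
      As \<open>R\<close> is an equivalence on the carrier, so is \<open>E\<close>; thus the step
      property spreads from the generators to all of \<open>R\<close>.\<close>
    define E where "E = {(x, y). x \<in> ?X \<and> y \<in> ?X \<and>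
      (\<forall>\<alpha>\<in>At T. rel_outcome (\<lambda>x y. (x, y) \<in> R) (=) (zeta ?K x \<alpha>) (zeta ?K y \<alpha>))}"
    have rel_iff: "rel_outcome (\<lambda>x y. (x, y) \<in> R) (=) (map_outcome Inl id a) (map_outcome Inr id b) \<longleftrightarrow>
        matches (\<lambda>_. False) (\<lambda>_. False) (\<lambda>x y. (Inl x, Inr y) \<in> R) a b"
      for a :: "('s, 'p) outcome" and b :: "('u, 'p) outcome"
      by (cases a; cases b) auto
    have "R \<subseteq> E"
    proof (rule R)
      let ?rel = "rel_outcome (\<lambda>x y. (x, y) \<in> R) (=)"
      have "?rel b a" if "?rel a b" for a b :: "('s + 'u, 'p) outcome"
        using that by (cases a; cases b) (auto intro: symD[OF sym])
      then show "sym E" by (auto simp: E_def sym_def)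
      have "?rel a c" if "?rel a b" "?rel b c" for a b c :: "('s + 'u, 'p) outcome"
        using that by (cases a; cases b; cases c) (auto intro: transD[OF trans])
      then show "trans E" unfolding E_def trans_def by blast
      show "Id_on ?X \<subseteq> E"
      proof
        fix p assume "p \<in> Id_on ?X"
        then obtain x where x: "p = (x, x)" "x \<in> ?X" by auto
        have "rel_outcome (\<lambda>x y. (x, y) \<in> R) (=) (zeta ?K x \<alpha>) (zeta ?K x \<alpha>)" if "\<alpha> \<in> At T" for \<alpha>
        proof (cases "zeta ?K x \<alpha>")
          \<comment> \<open>\<open>R\<close> is known to be reflexive only on the carrier, so the
            successor must be shown to lie there.\<close>
          case (Step y q)
          with gkat_automaton_sum_gkat[OF M N] that x(2) have "y \<in> states ?K"
            unfolding gkat_automaton_def by (metis sum_gkat_def gkat.select_convs(1))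
          then have "(y, y) \<in> R" using refl by (auto simp: sum_gkat_def)
          with Step show ?thesis by simp
        qed simp_all
        then show "p \<in> E" using x by (simp add: E_def)
      qed
      show "progress R \<subseteq> E"
        by (auto simp: progress_def E_def matched_def sum_gkat_def sum_zeta_def rel_iff)
    qed
    \<comment> \<open>Pairs within one automaton only served to chain mixed pairs together. A mixed
      pair has mixed successors, so the mixed part of \<open>R\<close> is a bisimulation by
      itself.\<close>
    then have "bisimulation T M N {(x, y). (Inl x, Inr y) \<in> R}"
      by (intro matches_bisimulation)
        (auto simp: E_def sum_gkat_def sum_zeta_def rel_iff dest!: subsetD[of R E])
    then show "bisimilar T M N s u"
      using su by (auto simp: bisimilar_def)
  qed
qed

theorem theorem3p2:
  fixes T :: "'t set" and \<Sigma> :: "'p set"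
    and M :: "('t, 's, 'p) gkat" and N :: "('t, 'u, 'p) gkat"
    and s :: 's and u :: 'u
    and atoms :: "'t atom list"
    and ok :: "'d \<Rightarrow> bool" and fresh :: 'd
    and rep :: "'d \<Rightarrow> 's + 'u \<Rightarrow> 's + 'u"
    and merge :: "'d \<Rightarrow> 's + 'u \<Rightarrow> 's + 'u \<Rightarrow> 'd"
    and C :: "('s + 'u) set"
  assumes "finite T"
    and "gkat_automaton T \<Sigma> M" and "gkat_automaton T \<Sigma> N"
    and "s \<in> states M" and "u \<in> states N"
    and "distinct atoms" and "set atoms = At T"
    and "union_find (states M <+> states N) ok fresh rep merge"
    and "C \<subseteq> {x \<in> states M. dead T M x} <+> {y \<in> states N. dead T N y}"
  shows "(\<exists>b \<sigma>. equiv_trace rep merge atoms M N s u (fresh, C) = Some (b, \<sigma>) \<and>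
            (b \<longleftrightarrow> traces T M s = traces T N u)) \<and>
         (\<exists>b \<sigma>. equiv_inf_trace rep merge atoms M N s u (fresh, C) = Some (b, \<sigma>) \<and>
            (b \<longleftrightarrow> bisimilar T M N s u))"

  using assms by (intro conjI equiv_trace_correct equiv_inf_trace_correct)

end
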